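(* Let $V$ and $\mathfrak g$ be finite-dimensional real vector spaces and $\langle\cdot,\cdot\rangle_{\mathfrak g}$ a scalar product on $\mathfrak g$ of neutral signature. Any Dirac structure of $V\oplus V^*\oplus\mathfrak g$ is of the form $$L=\{X+\xi+\sigma(X)+r\mid X\in W,\ \xi\in V^*,\ r\in\mathcal D,\ \xi(Y)=2\epsilon(X,Y)-\langle\sigma(Y),\sigma(X)+2r\rangle_{\mathfrak g}\ \ \forall Y\in W\},\qquad( * )$$ where $W\subset V$ is a subspace, $\mathcal D\subset\mathfrak g$ is a Dirac structure, $\sigma\in\mathrm{Hom}(W,\mathfrak g)$ and $\epsilon\in\Lambda^2W^*$. Conversely, any choice of such data $(W,\mathcal D,\sigma,\epsilon)$ defines by $( * )$ a Dirac structure $L=L(W,\mathcal D,\sigma,\epsilon)\subset V\oplus V^*\oplus\mathfrak g$. The homomorphism $\sigma$ automatically satisfies $\sigma(X)\in\mathcal D_X$ for all $X\in W$, where $\mathcal D_X:=\pi_{\mathfrak g}\big((\pi_V|_L)^{-1}(X)\big)$ is defined with respect to $L=L(W,\mathcal D,\sigma,\epsilon)$.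
   Context: $V\oplus V^*\oplus\mathfrak g$ carries the scalar product $\langle X+\xi+r,Y+\eta+s\rangle=\frac12(\xi(Y)+\eta(X))+\langle r,s\rangle_{\mathfrak g}$, and $\pi_V,\pi_{\mathfrak g}$ denote the projections onto $V,\mathfrak g$. A Dirac structure of a vector space with scalar product of neutral signature is a maximal isotropic subspace (of half the dimension). A scalar product is a non-degenerate symmetric bilinear form. *)

theory Defs
  imports "HOL-Analysis.Analysis"
begin

text \<open>The algebraic dual. Vector spaces are types of class \<^class>\<open>real_vector\<close> rather than
  \<^class>\<open>euclidean_space\<close>, because the latter excludes the zero space.\<close>

typedef (overloaded) 'v dual = "{f :: 'v::real_vector \<Rightarrow> real. linear f}"
  morphisms dual_apply Abs_dual
  by (rule exI[of _ "\<lambda>_. 0"]) (simp add: linear_iff)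

setup_lifting type_definition_dual

instantiation dual :: (real_vector) real_vector
begin

lift_definition zero_dual :: "'a dual" is "\<lambda>_. 0"
  by (simp add: linear_iff)

lift_definition plus_dual :: "'a dual \<Rightarrow> 'a dual \<Rightarrow> 'a dual" is "\<lambda>f g x. f x + g x"
  by (simp add: linear_iff algebra_simps)

lift_definition minus_dual :: "'a dual \<Rightarrow> 'a dual \<Rightarrow> 'a dual" is "\<lambda>f g x. f x - g x"
  by (simp add: linear_iff algebra_simps)

lift_definition uminus_dual :: "'a dual \<Rightarrow> 'a dual" is "\<lambda>f x. - f x"
  by (simp add: linear_iff)

lift_definition scaleR_dual :: "real \<Rightarrow> 'a dual \<Rightarrow> 'a dual" is "\<lambda>c f x. c * f x"
  by (simp add: linear_iff algebra_simps)

instance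
  by standard (transfer; simp add: fun_eq_iff algebra_simps)+

end

definition is_scalar_product :: "('a::real_vector \<Rightarrow> 'a \<Rightarrow> real) \<Rightarrow> bool" where
  "is_scalar_product b \<longleftrightarrow>
     bilinear b \<and> (\<forall>x y. b x y = b y x) \<and> (\<forall>x. (\<forall>y. b x y = 0) \<longrightarrow> x = 0)"

definition has_signature :: "('a::real_vector \<Rightarrow> 'a \<Rightarrow> real) \<Rightarrow> nat \<Rightarrow> nat \<Rightarrow> bool" where
  "has_signature b p q \<longleftrightarrow>
     (\<exists>B. finite B \<and> independent B \<and> span B = UNIV \<and> pairwise (\<lambda>x y. b x y = 0) B \<and>
          card {x \<in> B. b x x > 0} = p \<and> card {x \<in> B. b x x < 0} = q)"

definition neutral_signature :: "('a::real_vector \<Rightarrow> 'a \<Rightarrow> real) \<Rightarrow> bool" where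
  "neutral_signature b \<longleftrightarrow> (\<exists>n. has_signature b n n)"

definition isotropic_subspace :: "('a::real_vector \<Rightarrow> 'a \<Rightarrow> real) \<Rightarrow> 'a set \<Rightarrow> bool" where
  "isotropic_subspace b L \<longleftrightarrow> subspace L \<and> (\<forall>x\<in>L. \<forall>y\<in>L. b x y = 0)"

definition dirac_structure :: "('a::real_vector \<Rightarrow> 'a \<Rightarrow> real) \<Rightarrow> 'a set \<Rightarrow> bool" where
  "dirac_structure b L \<longleftrightarrow>
     isotropic_subspace b L \<and>
     (\<forall>L'. isotropic_subspace b L' \<and> L \<subseteq> L' \<longrightarrow> L' = L) \<and>
     2 * dim L = dim (UNIV :: 'a set)"

text \<open>An element \<open>X + \<xi> + r\<close> of \<open>V \<oplus> V\<^sup>* \<oplus> \<gg>\<close> is the triple \<open>(X, \<xi>, r)\<close>.\<close>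

type_synonym ('v, 'g) sum_space = "'v \<times> 'v dual \<times> 'g"

definition proj_V :: "('v::real_vector, 'g::real_vector) sum_space \<Rightarrow> 'v" where
  "proj_V = (\<lambda>(X, \<xi>, r). X)"

definition proj_g :: "('v::real_vector, 'g::real_vector) sum_space \<Rightarrow> 'g" where
  "proj_g = (\<lambda>(X, \<xi>, r). r)"

definition sum_form ::
  "('g::real_vector \<Rightarrow> 'g \<Rightarrow> real) \<Rightarrow>
   ('v::real_vector, 'g) sum_space \<Rightarrow> ('v, 'g) sum_space \<Rightarrow> real" where
  "sum_form b = (\<lambda>(X, \<xi>, r) (Y, \<eta>, s). (dual_apply \<xi> Y + dual_apply \<eta> X) / 2 + b r s)"

text \<open>Maps with domain a subspace \<open>W\<close> are total functions whose values outside \<open>W\<close> are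
  irrelevant.\<close>

definition linear_on :: "'a::real_vector set \<Rightarrow> ('a \<Rightarrow> 'b::real_vector) \<Rightarrow> bool" where
  "linear_on W f \<longleftrightarrow>
     (\<forall>x\<in>W. \<forall>y\<in>W. f (x + y) = f x + f y) \<and> (\<forall>c. \<forall>x\<in>W. f (c *\<^sub>R x) = c *\<^sub>R f x)"

definition alternating_form_on :: "'a::real_vector set \<Rightarrow> ('a \<Rightarrow> 'a \<Rightarrow> real) \<Rightarrow> bool" where
  "alternating_form_on W \<epsilon> \<longleftrightarrow>
     (\<forall>x\<in>W. linear_on W (\<lambda>y. \<epsilon> x y)) \<and> (\<forall>y\<in>W. linear_on W (\<lambda>x. \<epsilon> x y)) \<and>
     (\<forall>x\<in>W. \<epsilon> x x = 0)"

definition dirac_data ::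
  "('g::real_vector \<Rightarrow> 'g \<Rightarrow> real) \<Rightarrow> 'v::real_vector set \<Rightarrow> 'g set \<Rightarrow>
   ('v \<Rightarrow> 'g) \<Rightarrow> ('v \<Rightarrow> 'v \<Rightarrow> real) \<Rightarrow> bool" where
  "dirac_data b W D \<sigma> \<epsilon> \<longleftrightarrow>
     subspace W \<and> dirac_structure b D \<and> linear_on W \<sigma> \<and> alternating_form_on W \<epsilon>"

definition dirac_of_data ::
  "('g::real_vector \<Rightarrow> 'g \<Rightarrow> real) \<Rightarrow> 'v::real_vector set \<Rightarrow> 'g set \<Rightarrow>
   ('v \<Rightarrow> 'g) \<Rightarrow> ('v \<Rightarrow> 'v \<Rightarrow> real) \<Rightarrow> ('v, 'g) sum_space set" where
  "dirac_of_data b W D \<sigma> \<epsilon> =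
     {(X, \<xi>, \<sigma> X + r) | X \<xi> r. X \<in> W \<and> r \<in> D \<and>
        (\<forall>Y\<in>W. dual_apply \<xi> Y = 2 * \<epsilon> X Y - b (\<sigma> Y) (\<sigma> X + 2 *\<^sub>R r))}"

definition fibre_g :: "('v::real_vector, 'g::real_vector) sum_space set \<Rightarrow> 'v \<Rightarrow> 'g set" where
  "fibre_g L X = proj_g ` {z \<in> L. proj_V z = X}"

end

theory Submission
  imports Defs
begin

text \<open>By the dual-basis dimension formula, Dirac structures of a finite-dimensional space with
  scalar product are exactly the subspaces equal to their own orthogonal complement. For
  \<open>L = L(W, D, \<sigma>, \<epsilon>)\<close> this is verified by testing a vector orthogonal to \<open>L\<close> against the elements
  of \<open>L\<close> with \<open>X = 0, r = 0\<close>, then with \<open>X = 0\<close>, then with \<open>r = 0\<close>. Conversely, a linear section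
  \<open>X \<mapsto> (X, \<alpha>(X), \<sigma>(X))\<close> of \<open>\<pi>\<^sub>V\<close> on \<open>L\<close> provides \<open>\<sigma>\<close> and
  \<open>\<epsilon>(X, Y) = (\<alpha>(X)(Y) + \<langle>\<sigma>(Y), \<sigma>(X)\<rangle>) / 2\<close>, and \<open>D = {r. \<exists>\<xi>. \<xi> + r \<in> L}\<close>; then
  \<open>L \<subseteq> L(W, D, \<sigma>, \<epsilon>)\<close>, and equality follows since both sides are their own complements.\<close>

section \<open>Orthogonal complements, dual bases and the dimension formula\<close>

definition orth_compl :: "('a::real_vector \<Rightarrow> 'a \<Rightarrow> real) \<Rightarrow> 'a set \<Rightarrow> 'a set" where
  "orth_compl b S = {x. \<forall>y\<in>S. b x y = 0}"

lemma orth_compl_antimono: "S \<subseteq> T \<Longrightarrow> orth_compl b T \<subseteq> orth_compl b S"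
  by (auto simp: orth_compl_def)

lemma subspace_orth_compl:
  assumes "bilinear b"
  shows "subspace (orth_compl b S)"
  using assms by (auto simp: subspace_def orth_compl_def bilinear_ladd bilinear_lmul bilinear_lzero)

lemma linear_sum_scaleR_form:
  assumes "bilinear b"
  shows "linear (\<lambda>x. \<Sum>c\<in>C. b x c *\<^sub>R c)"
  using assms
  by (auto intro!: linearI simp: bilinear_ladd bilinear_lmul scaleR_add_left sum.distrib scaleR_sum_right)

lemma form_eq_0_on_span:
  assumes "bilinear b" "\<And>c. c \<in> C \<Longrightarrow> b x c = 0" "y \<in> span C"
  shows "b x y = 0"
  using assms(3)
proof (induction rule: span_induct_alt)
  case base
  show ?case using assms(1) by (simp add: bilinear_rzero)
next
  case (step c y z)
  then show ?case using assms by (simp add: bilinear_radd bilinear_rmul)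
qed

text \<open>The class \<open>real_vector\<close> carries no finiteness. A finite basis gives entry
  to the locale in which injective endomorphisms are surjective and nested subspaces are compared by
  dimension.\<close>

lemma finite_dimensional_real_vector:
  assumes "finite C" "independent C" "span C = UNIV"
  shows "finite_dimensional_vector_space ((*\<^sub>R) :: real \<Rightarrow> 'a::real_vector \<Rightarrow> 'a) C"
  using assms
  by unfold_locales (simp_all add: dependent_raw_def span_raw_def)

text \<open>The map \<open>f\<close> sending x to the sum of \<open>b x c *\<^sub>R c\<close> over
  the basis is injective by non-degeneracy, hence surjective in finite dimension. A preimage of c
  under \<open>f\<close> is the vector dual to c.\<close>

lemma ex_dual_basis:
  fixes b :: "'a::real_vector \<Rightarrow> 'a \<Rightarrow> real"
  assumes b: "is_scalar_product b" and C: "finite C" "independent C" "span C = UNIV"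
  obtains d where "\<And>c c'. c \<in> C \<Longrightarrow> c' \<in> C \<Longrightarrow> b (d c) c' = (if c' = c then 1 else 0)"
proof -
  define f where "f x = (\<Sum>c\<in>C. b x c *\<^sub>R c)" for x
  have bl: "bilinear b" and nondeg: "\<And>x. \<forall>y. b x y = 0 \<Longrightarrow> x = 0"
    using b by (auto simp: is_scalar_product_def)
  have lin: "linear f" unfolding f_def by (rule linear_sum_scaleR_form[OF bl])
  interpret fd: finite_dimensional_vector_space_pair
    "(*\<^sub>R) :: real \<Rightarrow> 'a \<Rightarrow> 'a" C "(*\<^sub>R) :: real \<Rightarrow> 'a \<Rightarrow> 'a" C
    using finite_dimensional_real_vector[OF C] finite_dimensional_real_vector[OF C]
    by (rule finite_dimensional_vector_space_pair.intro)
  have "inj f"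
    unfolding linear_injective_0[OF lin]
  proof (intro allI impI)
    fix x assume "f x = 0"
    then have "b x c = 0" if "c \<in> C" for c
      using independentD[OF C(2,1) subset_refl, of "b x"] that by (simp add: f_def)
    then show "x = 0"
      using form_eq_0_on_span[OF bl, of C] C(3) by (intro nondeg) auto
  qed
  then have "surj f"
    using lin by (intro fd.linear_injective_imp_surjective) (auto simp: linear_def)
  then obtain d where d: "\<And>y. f (d y) = y" by (metis surj_def)
  have "b (d c) c' = (if c' = c then 1 else 0)" if "c \<in> C" "c' \<in> C" for c c'
  proof -
    have "(\<Sum>e\<in>C. (b (d c) e - (if e = c then 1 else 0)) *\<^sub>R e) = f (d c) - c"
      using that(1) C(1)
      by (simp add: f_def scaleR_diff_left sum_subtractf if_distrib[of "\<lambda>t. t *\<^sub>R _"] sum.delta cong: if_cong)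
    then show ?thesis
      using independentD[OF C(2,1) subset_refl, of "\<lambda>e. b (d c) e - (if e = c then 1 else 0)" c'] that(2)
      by (simp add: d)
  qed
  then show thesis by (rule that)
qed

text \<open>A basis \<open>B\<close> of \<open>S\<close> is extended to a basis \<open>C\<close> of
  the whole space. The dual vectors \<open>d c\<close> with c in \<open>C - B\<close> form a basis
  of the complement, so the two dimensions add up to \<open>card C\<close>.\<close>

lemma dim_orth_compl:
  fixes b :: "'a::real_vector \<Rightarrow> 'a \<Rightarrow> real"
  assumes b: "is_scalar_product b" and A: "finite A" "span A = (UNIV :: 'a set)" and S: "subspace S"
  shows "dim S + dim (orth_compl b S) = dim (UNIV :: 'a set)"
proof -
  have bl: "bilinear b" and nondeg: "\<And>x. \<forall>y. b x y = 0 \<Longrightarrow> x = 0"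
    using b by (auto simp: is_scalar_product_def)
  obtain B where B: "B \<subseteq> S" "independent B" "S \<subseteq> span B" "card B = dim S"
    by (rule basis_exists)
  obtain C where C: "B \<subseteq> C" "independent C" "span C = UNIV"
    by (metis maximal_independent_subset_extend[OF subset_UNIV B(2)] top.extremum_uniqueI)
  have finC: "finite C"
    using independent_span_bound[OF A(1) C(2)] A(2) by auto
  obtain d where d: "\<And>c c'. c \<in> C \<Longrightarrow> c' \<in> C \<Longrightarrow> b (d c) c' = (if c' = c then 1 else 0)"
    using ex_dual_basis[OF b finC C(2,3)] by blast
  let ?E = "d ` (C - B)"
  have inj: "inj_on d C"
    by (rule inj_onI) (metis d zero_neq_one)
  \<comment> \<open>Pairing with c reads off the coefficient of \<open>d c\<close>. This serves both
    the independence of \<open>?E\<close> and the expansion of vectors of the complement.\<close>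
  have coeff: "b (\<Sum>e\<in>C - B. u e *\<^sub>R d e) c = (if c \<in> B then 0 else u c)" if "c \<in> C" for u c
  proof -
    have "b (\<Sum>e\<in>C - B. u e *\<^sub>R d e) c = (\<Sum>e\<in>C - B. u e * b (d e) c)"
      using linear_sum[of "\<lambda>x. b x c" "\<lambda>e. u e *\<^sub>R d e" "C - B"] bl
      by (simp add: bilinear_def bilinear_lmul[OF bl])
    also have "\<dots> = (\<Sum>e\<in>C - B. if e = c then u e else 0)"
      using that by (intro sum.cong) (auto simp: d)
    finally show ?thesis
      using that finC by (simp add: sum.delta)
  qed
  have "independent ?E"
  proof (rule independent_if_scalars_zero)
    show "finite ?E" using finC by simp
    fix u x
    assume 0: "(\<Sum>x\<in>?E. u x *\<^sub>R x) = 0" and "x \<in> ?E"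
    then obtain c where c: "c \<in> C" "c \<notin> B" "x = d c" by auto
    have "(\<Sum>e\<in>C - B. u (d e) *\<^sub>R d e) = 0"
      using 0 inj by (subst (asm) sum.reindex) (auto intro: inj_on_subset)
    then show "u x = 0"
      using coeff[OF c(1), of "\<lambda>e. u (d e)"] c by (simp add: bilinear_lzero[OF bl])
  qed
  moreover have "?E \<subseteq> orth_compl b S"
  proof -
    have "b (d c) y = 0" if c: "c \<in> C - B" and y: "y \<in> S" for c y
    proof (rule form_eq_0_on_span[OF bl])
      show "b (d c) c' = 0" if "c' \<in> B" for c'
        using d[of c c'] c that C(1) by auto
      show "y \<in> span B" using y B(3) by auto
    qed
    then show ?thesis by (auto simp: orth_compl_def)
  qed
  moreover have "orth_compl b S \<subseteq> span ?E"
  proof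
    fix x assume x: "x \<in> orth_compl b S"
    let ?s = "\<Sum>e\<in>C - B. b x e *\<^sub>R d e"
    \<comment> \<open>For c outside \<open>B\<close> the coefficients of \<open>?s\<close> are
      chosen to match; for c in \<open>B\<close> both \<open>b x c\<close> and \<open>b ?s c\<close>
      vanish, as x is orthogonal to \<open>S\<close>.\<close>
    have "b (x - ?s) c = 0" if "c \<in> C" for c
      using x B(1) that by (auto simp: bilinear_lsub[OF bl] coeff orth_compl_def)
    then have "x - ?s = 0"
      using form_eq_0_on_span[OF bl, of C] C(3) by (intro nondeg) auto
    moreover have "?s \<in> span ?E"
      by (intro span_sum span_scale span_base) auto
    ultimately show "x \<in> span ?E" by simp
  qed
  ultimately have "dim (orth_compl b S) = card ?E"
    by (metis basis_card_eq_dim)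
  also have "\<dots> = card C - card B"
    using inj C(1) finC by (metis Diff_subset card_Diff_subset card_image finite_subset inj_on_subset)
  finally show ?thesis
    using B(4) C finC card_mono[OF finC C(1)] basis_card_eq_dim[of C UNIV] by simp
qed

text \<open>Isotropy places \<open>L\<close> inside its complement, and half dimension leaves no
  room between them. Conversely, an isotropic \<open>L'\<close> above \<open>L\<close> lies in its
  own complement, hence in that of \<open>L\<close>, which is \<open>L\<close> itself.\<close>

lemma dirac_structure_iff_orth_compl:
  fixes b :: "'a::real_vector \<Rightarrow> 'a \<Rightarrow> real"
  assumes b: "is_scalar_product b" and A: "finite A" "span A = (UNIV :: 'a set)"
  shows "dirac_structure b L \<longleftrightarrow> orth_compl b L = L"
proof
  assume L: "dirac_structure b L"
  then have sub: "subspace L" and "L \<subseteq> orth_compl b L" and dim: "2 * dim L = dim (UNIV :: 'a set)"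
    by (auto simp: dirac_structure_def isotropic_subspace_def orth_compl_def)
  moreover have "subspace (orth_compl b L)"
    using b subspace_orth_compl by (auto simp: is_scalar_product_def)
  moreover have "dim (orth_compl b L) \<le> dim L"
    using dim_orth_compl[OF b A sub] dim by simp
  moreover obtain C where C: "independent C" "span C = (UNIV :: 'a set)"
    by (metis maximal_independent_subset[of UNIV] top.extremum_uniqueI)
  then interpret finite_dimensional_vector_space "(*\<^sub>R) :: real \<Rightarrow> 'a \<Rightarrow> 'a" C
    using independent_span_bound[OF A(1) C(1)] A(2) by (intro finite_dimensional_real_vector) auto
  show "orth_compl b L = L"
    using calculation subspace_dim_equal[of L "orth_compl b L"]
    by (simp add: subspace_raw_def dim_raw_def)
next
  assume L: "orth_compl b L = L"
  have sub: "subspace L"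
    using subspace_orth_compl[of b L] b by (simp add: L is_scalar_product_def)
  have iso: "\<And>x y. x \<in> L \<Longrightarrow> y \<in> L \<Longrightarrow> b x y = 0"
    using L by (auto simp: orth_compl_def)
  have "L' = L" if "isotropic_subspace b L'" "L \<subseteq> L'" for L'
  proof -
    have "L' \<subseteq> orth_compl b L'"
      using that(1) by (auto simp: isotropic_subspace_def orth_compl_def)
    then show ?thesis using orth_compl_antimono[OF that(2)] that(2) L by blast
  qed
  then show "dirac_structure b L"
    using sub iso dim_orth_compl[OF b A sub] L
    by (auto simp: dirac_structure_def isotropic_subspace_def)
qed

section \<open>Finite-dimensionality of the dual and of products; the scalar product on the
  sum\<close>

lemma linear_dual_apply: "linear (dual_apply \<xi>)"
  using dual_apply by blast

lemmas dual_apply_simps = zero_dual.rep_eq plus_dual.rep_eq minus_dual.rep_eq uminus_dual.rep_eq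
  scaleR_dual.rep_eq
  linear_add[OF linear_dual_apply] linear_diff[OF linear_dual_apply]
  linear_cmul[OF linear_dual_apply] linear_0[OF linear_dual_apply]

text \<open>The coordinate functionals \<open>e v\<close> of a finite basis span the dual: every
  \<xi> is the sum of the \<open>e v\<close> with coefficients
  \<open>dual_apply \<xi> v\<close>.\<close>

lemma finite_spanning_set_dual:
  fixes A :: "'v::real_vector set"
  assumes "finite A" "span A = UNIV"
  obtains E :: "'v dual set" where "finite E" "span E = UNIV"
proof -
  obtain B :: "'v set" where B: "independent B" "span B = UNIV"
    by (metis maximal_independent_subset[of UNIV] top.extremum_uniqueI)
  then have fin: "finite B"
    using independent_span_bound[OF assms(1) B(1)] assms(2) by auto
  define e where "e v = Abs_dual (\<lambda>x. representation B x v)" for v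
  have e: "dual_apply (e v) x = representation B x v" for v x
  proof -
    have "linear (\<lambda>x. representation B x v)"
      using B by (auto intro!: linearI simp: representation_add representation_scale)
    then show ?thesis by (simp add: e_def Abs_dual_inverse)
  qed
  have "\<xi> \<in> span (e ` B)" for \<xi>
  proof -
    have app: "dual_apply (sum g T) x = (\<Sum>v\<in>T. dual_apply (g v) x)" if "finite T"
      for g :: "'v \<Rightarrow> 'v dual" and T x
      using that by induction (simp_all add: dual_apply_simps)
    have "dual_apply (\<Sum>v\<in>B. dual_apply \<xi> v *\<^sub>R e v) x = dual_apply \<xi> x" for x
    proof -
      have "dual_apply \<xi> x = dual_apply \<xi> (\<Sum>v\<in>B. representation B x v *\<^sub>R v)"
        using B fin by (simp add: sum_representation_eq)
      also have "\<dots> = (\<Sum>v\<in>B. representation B x v * dual_apply \<xi> v)"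
        by (simp add: linear_sum[OF linear_dual_apply] dual_apply_simps)
      finally show ?thesis
        using fin by (simp add: app e dual_apply_simps mult.commute)
    qed
    then have "\<xi> = (\<Sum>v\<in>B. dual_apply \<xi> v *\<^sub>R e v)"
      by (simp add: dual_apply_inject[symmetric] fun_eq_iff)
    also have "\<dots> \<in> span (e ` B)"
      by (intro span_sum span_scale span_base) auto
    finally show ?thesis .
  qed
  then show thesis using fin that[of "e ` B"] by auto
qed

lemma finite_spanning_set_prod:
  fixes A :: "'a::real_vector set" and B :: "'b::real_vector set"
  assumes "finite A" "span A = UNIV" "finite B" "span B = UNIV"
  obtains E :: "('a \<times> 'b) set" where "finite E" "span E = UNIV"
proof -
  let ?E = "(\<lambda>x. (x, 0)) ` A \<union> (\<lambda>y. (0, y)) ` B"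
  have l: "linear (\<lambda>x. (x, 0) :: 'a \<times> 'b)" "linear (\<lambda>y. (0, y) :: 'a \<times> 'b)"
    by (auto intro!: linearI)
  have "(x, y) \<in> span ?E" for x y
  proof -
    have "(x, 0 :: 'b) \<in> span ((\<lambda>x. (x, 0)) ` A)"
      using linear_span_image[OF l(1), of A] assms(2) by auto
    then have "(x, 0) \<in> span ?E" by (meson Un_upper1 span_mono subsetD)
    moreover have "(0 :: 'a, y) \<in> span ((\<lambda>y. (0, y)) ` B)"
      using linear_span_image[OF l(2), of B] assms(4) by auto
    then have "(0, y) \<in> span ?E" by (meson Un_upper2 span_mono subsetD)
    ultimately have "(x, 0) + (0, y) \<in> span ?E" by (rule span_add)
    then show ?thesis by simp
  qed
  then have "span ?E = UNIV" by auto
  then show thesis using assms(1,3) by (intro that[of ?E]) auto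
qed

text \<open>Non-degeneracy is tested one summand at a time: vectors of \<g> detect r by
  non-degeneracy of \<open>b\<close>, vectors of V detect \<xi>, and functionals separate X from
  0.\<close>

lemma is_scalar_product_sum_form:
  fixes b :: "'g::real_vector \<Rightarrow> 'g \<Rightarrow> real"
  assumes b: "is_scalar_product b"
  shows "is_scalar_product (sum_form b :: ('v::real_vector, 'g) sum_space \<Rightarrow> _)"
proof -
  have bl: "bilinear b" and sym: "\<And>x y. b x y = b y x" and nondeg: "\<And>x. \<forall>y. b x y = 0 \<Longrightarrow> x = 0"
    using b by (auto simp: is_scalar_product_def)
  note bs = bilinear_ladd[OF bl] bilinear_radd[OF bl] bilinear_lmul[OF bl] bilinear_rmul[OF bl]
    bilinear_lzero[OF bl] bilinear_rzero[OF bl]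
  have "bilinear (sum_form b :: ('v, 'g) sum_space \<Rightarrow> _)"
    by (auto simp: bilinear_def linear_iff sum_form_def bs dual_apply_simps field_simps)
  moreover have "sum_form b x y = sum_form b y x" for x y :: "('v, 'g) sum_space"
    by (auto simp: sum_form_def sym split: prod.splits)
  moreover have "z = 0" if z: "\<forall>y. sum_form b z y = 0" for z :: "('v, 'g) sum_space"
  proof -
    obtain X \<xi> r where zz: "z = (X, \<xi>, r)" by (cases z)
    have "r = 0"
    proof (intro nondeg allI)
      show "b r s = 0" for s
        using z[rule_format, of "(0, 0, s)"] by (simp add: zz sum_form_def dual_apply_simps)
    qed
    moreover have "\<xi> = 0"
    proof -
      have "dual_apply \<xi> Y = 0" for Y
        using z[rule_format, of "(Y, 0, 0)"] by (simp add: zz sum_form_def dual_apply_simps bs)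
      then show ?thesis by (simp add: dual_apply_inject[symmetric] fun_eq_iff dual_apply_simps)
    qed
    moreover have "X = 0"
    proof (rule ccontr)
      assume "X \<noteq> 0"
      then obtain f :: "'v \<Rightarrow> real" where f: "linear f" "f X = 1"
        using linear_independent_extend[of "{X}" "\<lambda>_. 1 :: real"] by auto
      show False
        using z[rule_format, of "(0, Abs_dual f, 0)"] f
        by (simp add: zz sum_form_def dual_apply_simps bs Abs_dual_inverse)
    qed
    ultimately show ?thesis by (simp add: zz zero_prod_def)
  qed
  ultimately show ?thesis by (simp add: is_scalar_product_def)
qed

section \<open>Functionals extending a form on a subspace, or separating a point from it\<close>

lemma ex_dual_extending:
  fixes f :: "'v::real_vector \<Rightarrow> real"
  assumes W: "subspace W" and f: "linear_on W f"
  obtains \<xi> where "\<And>Y. Y \<in> W \<Longrightarrow> dual_apply \<xi> Y = f Y"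
proof -
  obtain B where B: "B \<subseteq> W" "independent B" "W \<subseteq> span B"
    by (rule maximal_independent_subset)
  obtain g where g: "linear g" "\<And>x. x \<in> B \<Longrightarrow> g x = f x"
    using linear_independent_extend[OF B(2), of f] by blast
  have W_eq: "span B = W" using B W by (simp add: span_minimal subset_antisym)
  have f0: "f 0 = 0" using f subspace_0[OF W] unfolding linear_on_def by (metis scaleR_zero_left)
  have "g Y = f Y" if "Y \<in> W" for Y
  proof -
    have "Y \<in> span B" using that W_eq by simp
    \<comment> \<open>Membership in \<open>W\<close> is carried through the induction, since
      \<open>f\<close> is known to be linear only there.\<close>
    then have "Y \<in> W \<and> g Y = f Y"
    proof (induction rule: span_induct_alt)
      case base
      show ?case using f0 g(1) W by (simp add: linear_0 subspace_0)
    next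
      case (step c x y)
      then have "x \<in> W" "c *\<^sub>R x \<in> W" using B(1) W by (auto simp: subspace_scale)
      moreover have "f (c *\<^sub>R x + y) = c *\<^sub>R f x + f y"
        using calculation f step by (simp add: linear_on_def)
      ultimately show ?case
        using step g W by (simp add: linear_add linear_cmul subspace_add)
    qed
    then show ?thesis by simp
  qed
  then show thesis using that[of "Abs_dual g"] g(1) by (simp add: Abs_dual_inverse)
qed

text \<open>A vector outside \<open>W\<close> stays independent of a basis of \<open>W\<close>, so a
  functional may be prescribed as 1 on it and 0 on that basis.\<close>

lemma ex_dual_separating:
  fixes W :: "'v::real_vector set"
  assumes W: "subspace W" and Z: "Z \<notin> W"
  obtains \<xi> where "\<And>Y. Y \<in> W \<Longrightarrow> dual_apply \<xi> Y = 0" "dual_apply \<xi> Z \<noteq> 0"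
proof -
  obtain B where B: "B \<subseteq> W" "independent B" "W \<subseteq> span B"
    by (rule maximal_independent_subset)
  have W_eq: "span B = W" using B W by (simp add: span_minimal subset_antisym)
  then have "independent (insert Z B)" using B Z by (simp add: independent_insert)
  then obtain g where g: "linear g" "\<And>x. x \<in> insert Z B \<Longrightarrow> g x = (if x = Z then 1 else 0 :: real)"
    using linear_independent_extend[of "insert Z B" "\<lambda>x. if x = Z then 1 else 0 :: real"] by blast
  have "g Y = 0" if "Y \<in> W" for Y
    using g B Z that W_eq by (intro linear_eq_0_on_span[of g B Y]) auto
  moreover have "g Z = 1" using g by simp
  ultimately show thesis using that[of "Abs_dual g"] g(1) by (simp add: Abs_dual_inverse)
qed

section \<open>The set built from the data is its own complement\<close>

lemma linear_on_diff:
  assumes "linear_on W f" "linear_on W g"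
  shows "linear_on W (\<lambda>x. f x - g x)"
  using assms by (auto simp: linear_on_def algebra_simps)

lemma linear_on_cmult:
  fixes f :: "'a::real_vector \<Rightarrow> real"
  assumes "linear_on W f"
  shows "linear_on W (\<lambda>x. k * f x)"
  using assms by (auto simp: linear_on_def algebra_simps)

lemma linear_on_form:
  assumes "bilinear b" "linear_on W \<sigma>"
  shows "linear_on W (\<lambda>Y. b (\<sigma> Y) s)"
  using assms by (auto simp: linear_on_def bilinear_ladd bilinear_lmul)

text \<open>Polarisation: expand the vanishing value of \<epsilon> on the pair (X + Y, X +
  Y).\<close>

lemma alternating_form_on_antisym:
  assumes "subspace W" "alternating_form_on W \<epsilon>" "X \<in> W" "Y \<in> W"
  shows "\<epsilon> Y X = - \<epsilon> X Y"
proof -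
  have XY: "X + Y \<in> W" using assms by (simp add: subspace_add)
  then have "\<epsilon> (X + Y) (X + Y) = \<epsilon> X (X + Y) + \<epsilon> Y (X + Y)"
    using assms(2-4) unfolding alternating_form_on_def linear_on_def by blast
  also have "\<epsilon> X (X + Y) = \<epsilon> X X + \<epsilon> X Y"
    using assms(2-4) unfolding alternating_form_on_def linear_on_def by blast
  also have "\<epsilon> Y (X + Y) = \<epsilon> Y X + \<epsilon> Y Y"
    using assms(2-4) unfolding alternating_form_on_def linear_on_def by blast
  finally show ?thesis using XY assms by (simp add: alternating_form_on_def)
qed

text \<open>The defining condition prescribes \<xi> on \<open>W\<close> alone, where its right-hand
  side is linear in Y. Hence X and r may be chosen freely, and some \<xi> completes them.\<close>

lemma ex_dirac_of_data_lift:
  assumes bl: "bilinear b" and data: "dirac_data b W D \<sigma> \<epsilon>" and "X \<in> W" "r \<in> D"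
  obtains \<xi> where "(X, \<xi>, \<sigma> X + r) \<in> dirac_of_data b W D \<sigma> \<epsilon>"
proof -
  have "linear_on W (\<lambda>Y. 2 * \<epsilon> X Y - b (\<sigma> Y) (\<sigma> X + 2 *\<^sub>R r))"
    using data \<open>X \<in> W\<close>
    by (intro linear_on_diff linear_on_cmult linear_on_form[OF bl])
       (auto simp: dirac_data_def alternating_form_on_def)
  then obtain \<xi> where "\<And>Y. Y \<in> W \<Longrightarrow> dual_apply \<xi> Y = 2 * \<epsilon> X Y - b (\<sigma> Y) (\<sigma> X + 2 *\<^sub>R r)"
    using ex_dual_extending data unfolding dirac_data_def by blast
  then show thesis using that assms(3,4) by (auto simp: dirac_of_data_def)
qed

lemma orth_compl_dirac_of_data:
  assumes b: "is_scalar_product b" and data: "dirac_data b W D \<sigma> \<epsilon>" and D: "orth_compl b D = D"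
  shows "orth_compl (sum_form b) (dirac_of_data b W D \<sigma> \<epsilon>) = dirac_of_data b W D \<sigma> \<epsilon>"
    (is "orth_compl _ ?L = ?L")
proof (intro subset_antisym subsetI)
  have bl: "bilinear b" and sym: "\<And>x y. b x y = b y x"
    using b by (auto simp: is_scalar_product_def)
  note bs = bilinear_ladd[OF bl] bilinear_radd[OF bl] bilinear_lmul[OF bl] bilinear_rmul[OF bl]
    bilinear_lzero[OF bl] bilinear_rzero[OF bl] bilinear_lsub[OF bl] bilinear_rsub[OF bl]
  have W: "subspace W" and \<sigma>: "linear_on W \<sigma>" and \<epsilon>: "alternating_form_on W \<epsilon>"
    using data by (auto simp: dirac_data_def)
  have W0: "0 \<in> W" using W by (rule subspace_0)
  have \<sigma>0: "\<sigma> 0 = 0" using \<sigma> W0 unfolding linear_on_def by (metis scaleR_zero_left)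
  have \<epsilon>0: "\<epsilon> 0 Y = 0" if "Y \<in> W" for Y
    using \<epsilon> that W0 unfolding alternating_form_on_def linear_on_def
    by (metis scaleR_zero_left)
  have D0: "0 \<in> D" using D bs by (auto simp: orth_compl_def)
  {
    fix z assume z: "z \<in> ?L"
    have "sum_form b z w = 0" if w: "w \<in> ?L" for w
    proof -
      from z obtain X \<xi> r where X: "z = (X, \<xi>, \<sigma> X + r)" "X \<in> W" "r \<in> D"
        "\<forall>Y\<in>W. dual_apply \<xi> Y = 2 * \<epsilon> X Y - b (\<sigma> Y) (\<sigma> X + 2 *\<^sub>R r)"
        by (auto simp: dirac_of_data_def)
      from w obtain Y \<eta> s where Y: "w = (Y, \<eta>, \<sigma> Y + s)" "Y \<in> W" "s \<in> D"
        "\<forall>X\<in>W. dual_apply \<eta> X = 2 * \<epsilon> Y X - b (\<sigma> X) (\<sigma> Y + 2 *\<^sub>R s)"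
        by (auto simp: dirac_of_data_def)
      have "b r s = 0" using D X(3) Y(3) by (auto simp: orth_compl_def)
      moreover have "dual_apply \<xi> Y = 2 * \<epsilon> X Y - b (\<sigma> Y) (\<sigma> X + 2 *\<^sub>R r)"
        "dual_apply \<eta> X = 2 * \<epsilon> Y X - b (\<sigma> X) (\<sigma> Y + 2 *\<^sub>R s)"
        using X(2,4) Y(2,4) by blast+
      \<comment> \<open>The \<epsilon> terms cancel by antisymmetry. The dual part of the pairing is
        then \<open>- b (\<sigma> X) (\<sigma> Y) - b (\<sigma> Y) r - b (\<sigma> X) s\<close>,
        which cancels the expansion of the \<g> part up to \<open>b r s = 0\<close>.\<close>
      ultimately show ?thesis
        unfolding X(1) Y(1) using alternating_form_on_antisym[OF W \<epsilon> X(2) Y(2)]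
          sym[of "\<sigma> X" "\<sigma> Y"] sym[of "\<sigma> Y" r]
        by (simp add: sum_form_def bs field_simps)
    qed
    then show "z \<in> orth_compl (sum_form b) ?L" by (auto simp: orth_compl_def)
  next
    fix z assume "z \<in> orth_compl (sum_form b) ?L"
    then have orth: "\<And>w. w \<in> ?L \<Longrightarrow> sum_form b z w = 0" by (auto simp: orth_compl_def)
    obtain Z \<zeta> t where z: "z = (Z, \<zeta>, t)" by (cases z)
    have ZW: "Z \<in> W"
    proof (rule ccontr)
      assume "Z \<notin> W"
      then obtain \<xi> where \<xi>: "\<And>Y. Y \<in> W \<Longrightarrow> dual_apply \<xi> Y = 0" "dual_apply \<xi> Z \<noteq> 0"
        using ex_dual_separating[OF W] by blast
      \<comment> \<open>For X = 0 and r = 0 the defining condition says only that \<xi> vanishes on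
        \<open>W\<close>.\<close>
      have "(0, \<xi>, \<sigma> 0 + 0) \<in> ?L"
        using W0 D0 \<xi>(1) \<epsilon>0 unfolding dirac_of_data_def by (force simp: \<sigma>0 bs)
      then show False
        using orth[of "(0, \<xi>, 0)"] \<xi>(2) by (simp add: z sum_form_def \<sigma>0 bs dual_apply_simps)
    qed
    \<comment> \<open>The element over X = 0 with \<g>-component r pairs with z to exactly this
      value, because its functional takes the value \<open>- 2 * b (\<sigma> Z) r\<close> at
      Z.\<close>
    have "b (t - \<sigma> Z) r = 0" if r: "r \<in> D" for r
    proof -
      obtain \<xi> where L: "(0, \<xi>, \<sigma> 0 + r) \<in> ?L"
        using ex_dirac_of_data_lift[OF bl data W0 r] by blast
      then have "dual_apply \<xi> Z = - 2 * b (\<sigma> Z) r"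
        using ZW \<epsilon>0[OF ZW] by (auto simp: dirac_of_data_def \<sigma>0 bs)
      then show ?thesis
        using orth[OF L] by (simp add: z sum_form_def \<sigma>0 bs dual_apply_simps)
    qed
    then have s: "t - \<sigma> Z \<in> D" using D by (auto simp: orth_compl_def)
    \<comment> \<open>Elements with r = 0 over each X in \<open>W\<close> determine \<zeta> on
      \<open>W\<close>. The last argument is \<open>2 *\<^sub>R t - \<sigma> Z\<close> in
      disguise.\<close>
    have "dual_apply \<zeta> X = 2 * \<epsilon> Z X - b (\<sigma> X) (\<sigma> Z + 2 *\<^sub>R (t - \<sigma> Z))" if X: "X \<in> W" for X
    proof -
      obtain \<xi> where L: "(X, \<xi>, \<sigma> X + 0) \<in> ?L"
        using ex_dirac_of_data_lift[OF bl data X D0] by blast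
      then have "dual_apply \<xi> Z = 2 * \<epsilon> X Z - b (\<sigma> Z) (\<sigma> X)"
        using ZW by (auto simp: dirac_of_data_def)
      then show ?thesis
        using orth[OF L] alternating_form_on_antisym[OF W \<epsilon> X ZW] sym[of t "\<sigma> X"]
          sym[of "\<sigma> Z" "\<sigma> X"]
        by (simp add: z sum_form_def bs field_simps)
    qed
    then show "z \<in> ?L"
      using ZW s unfolding z dirac_of_data_def by force
  }
qed

section \<open>Recovering the data from a self-complementary subspace\<close>

lemma dirac_data_of_orth_compl:
  fixes L :: "('v::real_vector, 'g::real_vector) sum_space set"
  assumes b: "is_scalar_product b" and A: "finite A" "span A = (UNIV :: 'g set)"
    and L: "orth_compl (sum_form b) L = L"
  obtains W D \<sigma> \<epsilon> where "dirac_data b W D \<sigma> \<epsilon>" "L = dirac_of_data b W D \<sigma> \<epsilon>"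
proof -
  have bl: "bilinear b" and sym: "\<And>x y. b x y = b y x"
    using b by (auto simp: is_scalar_product_def)
  note bs = bilinear_ladd[OF bl] bilinear_radd[OF bl] bilinear_lmul[OF bl] bilinear_rmul[OF bl]
    bilinear_lzero[OF bl] bilinear_rzero[OF bl] bilinear_lsub[OF bl] bilinear_rsub[OF bl]
  have sub: "subspace L"
    using subspace_orth_compl[of "sum_form b" L] is_scalar_product_sum_form[OF b, where 'v = 'v]
    by (simp add: L is_scalar_product_def)
  have iso: "\<And>z w. z \<in> L \<Longrightarrow> w \<in> L \<Longrightarrow> sum_form b z w = 0"
    using L by (auto simp: orth_compl_def)
  define W where "W = proj_V ` L"
  define D where "D = {r. \<exists>\<xi>. (0, \<xi>, r) \<in> L}"
  have lin: "linear (proj_V :: ('v, 'g) sum_space \<Rightarrow> 'v)"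
    by (auto intro!: linearI simp: proj_V_def)
  have W: "subspace W"
    unfolding W_def using lin sub by (rule linear_subspace_image)
  \<comment> \<open>The section is linear on all of V with values in \<open>L\<close>, so its
    components \<alpha> and \<sigma> are linear everywhere; only the section identity is confined to
    \<open>W\<close>.\<close>
  obtain \<tau> where \<tau>: "\<And>X. \<tau> X \<in> L" "linear \<tau>" "\<And>X. X \<in> W \<Longrightarrow> proj_V (\<tau> X) = X"
    using linear_exists_right_inverse_on[OF lin sub] unfolding W_def by blast
  define \<alpha> where "\<alpha> X = fst (snd (\<tau> X))" for X
  define \<sigma> where "\<sigma> X = snd (snd (\<tau> X))" for X
  have \<tau>_eq: "\<tau> X = (X, \<alpha> X, \<sigma> X)" if "X \<in> W" for X
    using \<tau>(3)[OF that] by (cases "\<tau> X") (simp add: \<alpha>_def \<sigma>_def proj_V_def)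
  have lift: "(X, \<alpha> X, \<sigma> X) \<in> L" if "X \<in> W" for X
    using \<tau>(1)[of X] that by (simp add: \<tau>_eq)
  have \<alpha>_add: "\<alpha> (X + Y) = \<alpha> X + \<alpha> Y" and \<alpha>_scale: "\<alpha> (c *\<^sub>R X) = c *\<^sub>R \<alpha> X"
    and \<sigma>_add: "\<sigma> (X + Y) = \<sigma> X + \<sigma> Y" and \<sigma>_scale: "\<sigma> (c *\<^sub>R X) = c *\<^sub>R \<sigma> X" for X Y c
    using \<tau>(2) by (simp_all add: \<alpha>_def \<sigma>_def linear_add linear_cmul)
  \<comment> \<open>Two elements of \<open>L\<close> over the same X differ by an element over 0,
    whose \<g>-component lies in \<open>D\<close> by definition.\<close>
  have in_D: "t - \<sigma> X \<in> D" "X \<in> W" if "(X, \<xi>, t) \<in> L" for X \<xi> t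
  proof -
    show X: "X \<in> W" using that by (force simp: W_def proj_V_def)
    have "(X, \<xi>, t) - (X, \<alpha> X, \<sigma> X) \<in> L"
      using that lift[OF X] by (rule subspace_diff[OF sub])
    then show "t - \<sigma> X \<in> D" by (auto simp: D_def)
  qed
  have D: "orth_compl b D = D"
  proof (intro subset_antisym subsetI)
    fix s assume s: "s \<in> orth_compl b D"
    \<comment> \<open>With this choice, the pairing of \<open>(0, \<xi>, s)\<close> with any
      \<open>(X, \<eta>, t)\<close> is \<open>b s (t - \<sigma> X)\<close>, which vanishes when the
      latter triple lies in \<open>L\<close>.\<close>
    define \<xi> where "\<xi> = Abs_dual (\<lambda>X. - 2 * b s (\<sigma> X))"
    have "linear (\<lambda>X. - 2 * b s (\<sigma> X))"
      by (auto intro!: linearI simp: \<sigma>_add \<sigma>_scale bs)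
    then have \<xi>: "dual_apply \<xi> X = - 2 * b s (\<sigma> X)" for X
      by (simp add: \<xi>_def Abs_dual_inverse)
    have "sum_form b (0, \<xi>, s) (X, \<eta>, t) = 0" if "(X, \<eta>, t) \<in> L" for X \<eta> t
    proof -
      have "b s (t - \<sigma> X) = 0" using s in_D(1)[OF that] by (auto simp: orth_compl_def)
      then show ?thesis by (simp add: sum_form_def \<xi> bs dual_apply_simps)
    qed
    then have "(0, \<xi>, s) \<in> orth_compl (sum_form b) L" by (auto simp: orth_compl_def)
    then show "s \<in> D" using L by (auto simp: D_def)
  next
    fix s assume "s \<in> D"
    then obtain \<xi> where \<xi>: "(0, \<xi>, s) \<in> L" by (auto simp: D_def)
    have "b s r = 0" if "r \<in> D" for r
    proof -
      from that obtain \<eta> where "(0, \<eta>, r) \<in> L" by (auto simp: D_def)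
      from iso[OF \<xi> this] show ?thesis by (simp add: sum_form_def dual_apply_simps)
    qed
    then show "s \<in> orth_compl b D" by (auto simp: orth_compl_def)
  qed
  \<comment> \<open>This is the defining condition at r = 0 and \<xi> = \<open>\<alpha> X\<close>,
    solved for \<epsilon>. Its vanishing on the diagonal is the isotropy of each lift with
    itself.\<close>
  define \<epsilon> where "\<epsilon> X Y = (dual_apply (\<alpha> X) Y + b (\<sigma> Y) (\<sigma> X)) / 2" for X Y
  have alt: "\<epsilon> X X = 0" if "X \<in> W" for X
    using iso[OF lift lift, OF that that] by (simp add: sum_form_def \<epsilon>_def)
  have "alternating_form_on W \<epsilon>"
    using alt
    by (auto simp: alternating_form_on_def linear_on_def \<epsilon>_def \<alpha>_add \<alpha>_scale \<sigma>_add \<sigma>_scale bs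
        dual_apply_simps field_simps)
  moreover have "linear_on W \<sigma>" by (simp add: linear_on_def \<sigma>_add \<sigma>_scale)
  moreover have "dirac_structure b D" using D dirac_structure_iff_orth_compl[OF b A] by blast
  ultimately have data: "dirac_data b W D \<sigma> \<epsilon>" using W by (simp add: dirac_data_def)
  have "L \<subseteq> dirac_of_data b W D \<sigma> \<epsilon>"
  proof
    fix z assume z: "z \<in> L"
    obtain X \<xi> t where zX: "z = (X, \<xi>, t)" by (cases z)
    have X: "X \<in> W" and r: "t - \<sigma> X \<in> D" using in_D z zX by auto
    \<comment> \<open>Orthogonality of z to the lift of Y expresses
      \<open>dual_apply \<xi> Y\<close> through \<open>dual_apply (\<alpha> Y) X\<close>;
      orthogonality of the lifts of X and Y trades the latter for
      \<open>dual_apply (\<alpha> X) Y\<close>.\<close>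
    have "dual_apply \<xi> Y = 2 * \<epsilon> X Y - b (\<sigma> Y) (\<sigma> X + 2 *\<^sub>R (t - \<sigma> X))" if Y: "Y \<in> W" for Y
      using iso[OF z lift[OF Y]] iso[OF lift[OF X] lift[OF Y]]
        sym[of "\<sigma> X" "\<sigma> Y"] sym[of t "\<sigma> Y"]
      by (simp add: zX sum_form_def \<epsilon>_def bs field_simps)
    then show "z \<in> dirac_of_data b W D \<sigma> \<epsilon>"
      using X r unfolding zX dirac_of_data_def by force
  qed
  then have "L = dirac_of_data b W D \<sigma> \<epsilon>"
    using orth_compl_antimono[of L "dirac_of_data b W D \<sigma> \<epsilon>" "sum_form b"] L
      orth_compl_dirac_of_data[OF b data D] by auto
  with data show thesis by (rule that)
qed

theorem proposition11:
  fixes BV :: "'v::real_vector set" and BG :: "'g::real_vector set"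
    and b :: "'g \<Rightarrow> 'g \<Rightarrow> real"
  assumes "finite_dimensional_vector_space ((*\<^sub>R) :: real \<Rightarrow> 'v \<Rightarrow> 'v) BV"
    and "finite_dimensional_vector_space ((*\<^sub>R) :: real \<Rightarrow> 'g \<Rightarrow> 'g) BG"
    and "is_scalar_product b" and "neutral_signature b"
  shows "(\<forall>L :: ('v, 'g) sum_space set. dirac_structure (sum_form b) L \<longrightarrow>
            (\<exists>W D \<sigma> \<epsilon>. dirac_data b W D \<sigma> \<epsilon> \<and> L = dirac_of_data b W D \<sigma> \<epsilon>)) \<and>
         (\<forall>(W :: 'v set) D \<sigma> \<epsilon>. dirac_data b W D \<sigma> \<epsilon> \<longrightarrow>
            dirac_structure (sum_form b) (dirac_of_data b W D \<sigma> \<epsilon>)) \<and>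
         (\<forall>(W :: 'v set) D \<sigma> \<epsilon>. dirac_data b W D \<sigma> \<epsilon> \<longrightarrow>
            (\<forall>X\<in>W. \<sigma> X \<in> fibre_g (dirac_of_data b W D \<sigma> \<epsilon>) X))"
proof -
  have V: "finite BV" "span BV = UNIV" and G: "finite BG" "span BG = UNIV"
    using finite_dimensional_vector_space.finite_Basis[OF assms(1)]
      finite_dimensional_vector_space.span_Basis[OF assms(1)]
      finite_dimensional_vector_space.finite_Basis[OF assms(2)]
      finite_dimensional_vector_space.span_Basis[OF assms(2)]
    by (simp_all add: span_raw_def)
  \<comment> \<open>The characterisation by complements asks for a finite spanning set, so one is
    built for the dual, then for the space of triples.\<close>
  obtain E :: "'v dual set" where E: "finite E" "span E = UNIV"
    using finite_spanning_set_dual[OF V] .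
  obtain F :: "('v dual \<times> 'g) set" where F: "finite F" "span F = UNIV"
    using finite_spanning_set_prod[OF E G] .
  obtain A :: "('v, 'g) sum_space set" where A: "finite A" "span A = UNIV"
    using finite_spanning_set_prod[OF V F] .
  have dirac_L: "dirac_structure (sum_form b) L \<longleftrightarrow> orth_compl (sum_form b) L = L"
    for L :: "('v, 'g) sum_space set"
    by (rule dirac_structure_iff_orth_compl[OF is_scalar_product_sum_form[OF assms(3)] A])
  have bl: "bilinear b" using assms(3) by (simp add: is_scalar_product_def)
  have D: "orth_compl b D = D" if "dirac_data b W D \<sigma> \<epsilon>" for W :: "'v set" and D \<sigma> \<epsilon>
    using that dirac_structure_iff_orth_compl[OF assms(3) G] by (simp add: dirac_data_def)
  have "\<sigma> X \<in> fibre_g (dirac_of_data b W D \<sigma> \<epsilon>) X"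
    if data: "dirac_data b W D \<sigma> \<epsilon>" and X: "X \<in> W" for W :: "'v set" and D \<sigma> \<epsilon> X
  proof -
    \<comment> \<open>Choosing r = 0 over X gives an element of the fibre whose \<g>-component is
      exactly \<open>\<sigma> X\<close>.\<close>
    have "0 \<in> D" using D[OF data] subspace_orth_compl[OF bl, of D] by (metis subspace_0)
    then obtain \<xi> where "(X, \<xi>, \<sigma> X + 0) \<in> dirac_of_data b W D \<sigma> \<epsilon>"
      using ex_dirac_of_data_lift[OF bl data X] by blast
    then show ?thesis by (force simp: fibre_g_def proj_g_def proj_V_def)
  qed
  moreover have "dirac_structure (sum_form b) (dirac_of_data b W D \<sigma> \<epsilon>)"
    if "dirac_data b W D \<sigma> \<epsilon>" for W :: "'v set" and D \<sigma> \<epsilon>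
    unfolding dirac_L by (rule orth_compl_dirac_of_data[OF assms(3) that D[OF that]])
  moreover have "\<exists>W D \<sigma> \<epsilon>. dirac_data b W D \<sigma> \<epsilon> \<and> L = dirac_of_data b W D \<sigma> \<epsilon>"
    if "dirac_structure (sum_form b) L" for L :: "('v, 'g) sum_space set"
    using that dirac_data_of_orth_compl[OF assms(3) G] unfolding dirac_L by metis
  ultimately show ?thesis by blast
qed

end
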